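(* Let $n,k$ be integers with $1\le k<n$, and let $X$ be an $(n-k)$-dimensional linear subspace of $\ell_\infty^n$ (with the norm inherited from $\ell_\infty^n$). Then all of the following hold: (1) $$e(X)\ \geq\ \frac{2^{n-k}}{(n-k)^k};$$ (2) for every integer $\ell$ with $1\le \ell\le \frac{n}{k+1}$, $$e(X)\ \geq\ 1+\frac{1}{2^{k-1}}\sum_{r=1}^{\ell}\binom{n-k\ell}{r};$$ (3) for every integer $\ell$ with $1\le \ell\le \frac{n}{2k+1}$, $$e(X)\ \geq\ 1+\sum_{r=1}^{\ell}\binom{n-2k\ell}{r}.$$
   Context: $\ell_\infty^n$ denotes the real normed space $(\mathbb{R}^n,\|\cdot\|_\infty)$ with $\|x\|_\infty=\max_{1\le i\le n}|x_i|$. For a normed space $(X,\|\cdot\|)$ and $c>0$, a set $S\subseteq X$ is called $c$-equilateral if $\|x-y\|=c$ for all distinct $x,y\in S$; $S$ is called equilateral if it is $c$-equilateral for some $c>0$. The equilateral number $e(X)$ is the cardinality of the largest equilateral set in $X$. *)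

theory Defs
  imports "HOL-Analysis.Analysis"
begin

text \<open>
  A normed space is given here by a real vector space together with an explicit norm function
  \<open>N\<close>, because the type class norm on \<open>real ^ 'n\<close> is the Euclidean one. The space
  \<open>\<ell>\<^sub>\<infinity>\<^sup>n\<close> is \<open>real ^ 'n\<close> with the norm \<open>infnorm\<close>, where \<open>n = CARD('n)\<close>; a linear subspace
  inherits its norm by restriction.
\<close>

definition c_equilateral :: "('a::real_vector \<Rightarrow> real) \<Rightarrow> real \<Rightarrow> 'a set \<Rightarrow> bool" where
  "c_equilateral N c S \<longleftrightarrow> (\<forall>x\<in>S. \<forall>y\<in>S. x \<noteq> y \<longrightarrow> N (x - y) = c)"

definition equilateral :: "('a::real_vector \<Rightarrow> real) \<Rightarrow> 'a set \<Rightarrow> bool" where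
  "equilateral N S \<longleftrightarrow> (\<exists>c>0. c_equilateral N c S)"

text \<open>
  The set whose maximum is taken is finite and nonempty for every \<open>X\<close> when \<open>N = infnorm\<close>
  on \<open>real ^ 'n\<close>, and infinite equilateral sets do not exist there; see
  \<open>equilateral_infnorm_finite\<close> and \<open>equilateral_number_infnorm\<close> below.
\<close>

definition equilateral_number :: "('a::real_vector \<Rightarrow> real) \<Rightarrow> 'a set \<Rightarrow> nat" where
  "equilateral_number N X = Max {card S |S. S \<subseteq> X \<and> finite S \<and> equilateral N S}"

lemma infnorm_eq_Max_cart: "infnorm (x :: real ^ 'n) = Max (range (\<lambda>i. \<bar>x $ i\<bar>))"
proof -
  have "infnorm x = Sup (range (\<lambda>i. \<bar>x $ i\<bar>))"
    by (simp add: infnorm_cart full_SetCompr_eq)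
  also have "\<dots> = Max (range (\<lambda>i. \<bar>x $ i\<bar>))"
    by (rule cSup_eq_Max) auto
  finally show ?thesis .
qed

lemma equilateral_infnorm_finite:
  fixes S :: "(real ^ 'n) set"
  assumes "equilateral infnorm S"
  shows "finite S" and "card S \<le> 2 ^ CARD('n)"
proof -
  obtain c where c: "c > 0" and S: "\<And>x y. x \<in> S \<Longrightarrow> y \<in> S \<Longrightarrow> x \<noteq> y \<Longrightarrow> infnorm (x - y) = c"
    using assms unfolding equilateral_def c_equilateral_def by blast
  define m where "m i = (INF x\<in>S. x $ i)" for i
  define f where "f x = {i. x $ i > m i + c / 2}" for x :: "real ^ 'n"
  have d: "\<bar>x $ i - y $ i\<bar> \<le> c" if "x \<in> S" "y \<in> S" for x y i
    using component_le_infnorm_cart[of "x - y" i] S[OF that] c by (cases "x = y") auto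
  have lo: "m i \<le> x $ i" if "x \<in> S" for x i
    unfolding m_def
  proof (rule cINF_lower[OF _ that])
    show "bdd_below ((\<lambda>x. x $ i) ` S)"
      by (rule bdd_belowI2[of _ "x $ i - c"]) (use d[OF that, of _ i] in fastforce)
  qed
  have hi: "x $ i \<le> m i + c" if "x \<in> S" for x i
  proof -
    have "x $ i - c \<le> m i"
      unfolding m_def by (rule cINF_greatest) (use that d[OF that, of _ i] in fastforce)+
    then show ?thesis by simp
  qed
  have inj: "inj_on f S"
  proof (rule inj_onI, rule ccontr)
    fix x y assume xy: "x \<in> S" "y \<in> S" "f x = f y" "x \<noteq> y"
    have "\<bar>(x - y) $ i\<bar> \<le> c / 2" for i
    proof -
      have "i \<in> f x \<longleftrightarrow> i \<in> f y" using xy by simp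
      then show ?thesis
        using lo[OF xy(1), of i] lo[OF xy(2), of i] hi[OF xy(1), of i] hi[OF xy(2), of i]
        unfolding f_def mem_Collect_eq vector_minus_component by linarith
    qed
    then have "infnorm (x - y) \<le> c / 2"
      unfolding infnorm_eq_Max_cart by (subst Max_le_iff) auto
    then show False using S[OF xy(1,2,4)] c by simp
  qed
  show "finite S"
    by (rule inj_on_finite[OF inj, of UNIV]) auto
  have "card S \<le> card (UNIV :: 'n set set)"
    by (rule card_inj_on_le[OF inj]) auto
  then show "card S \<le> 2 ^ CARD('n)"
    by (simp flip: Pow_UNIV add: card_Pow)
qed

lemma equilateral_number_infnorm:
  fixes X :: "(real ^ 'n) set"
  shows "\<exists>S\<subseteq>X. equilateral infnorm S \<and> card S = equilateral_number infnorm X"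
    and "S \<subseteq> X \<Longrightarrow> equilateral infnorm S \<Longrightarrow> card S \<le> equilateral_number infnorm X"
proof -
  let ?A = "{card S |S. S \<subseteq> X \<and> finite S \<and> equilateral infnorm S}"
  have "?A \<subseteq> {..2 ^ CARD('n)}"
    using equilateral_infnorm_finite(2) by auto
  then have fin: "finite ?A"
    by (rule finite_subset) simp
  have "equilateral infnorm ({} :: (real ^ 'n) set)"
    unfolding equilateral_def c_equilateral_def by (auto intro: exI[of _ 1])
  then have ne: "?A \<noteq> {}"
    by blast
  show "\<exists>S\<subseteq>X. equilateral infnorm S \<and> card S = equilateral_number infnorm X"
    using Max_in[OF fin ne] unfolding equilateral_number_def by auto
  show "card S \<le> equilateral_number infnorm X" if "S \<subseteq> X" "equilateral infnorm S"
    unfolding equilateral_number_def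
    by (rule Max_ge[OF fin]) (use that equilateral_infnorm_finite(1) in blast)
qed

end

theory Submission
  imports Defs
begin

text \<open>
  Let \<open>n = CARD('n)\<close> and let \<open>X\<close> have codimension \<open>k\<close>. All three bounds come from one extremal
  choice. Fix \<open>L \<ge> 1\<close> and call a vector with entries in \<open>{-1, 0, 1}\<close> and at most \<open>L\<close> nonzero
  entries a sign vector. Among all \<open>k\<close>-tuples of sign vectors with pairwise disjoint supports
  take \<open>z\<^sub>1, \<dots>, z\<^sub>k\<close> for which the determinant of \<open>z\<^sub>1, \<dots>, z\<^sub>k\<close> together with a basis of \<open>X\<close>
  is largest in absolute value. Every \<open>x\<close> is congruent modulo \<open>X\<close> to a unique combination
  \<open>c\<^sub>1(x) z\<^sub>1 + \<dots> + c\<^sub>k(x) z\<^sub>k\<close>, and Cramer's rule with maximality gives \<open>\<bar>c\<^sub>i(x)\<bar> \<le> 1\<close> whenever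
  \<open>x\<close> is itself a sign vector whose support misses those of the \<open>z\<^sub>j\<close>, because \<open>x\<close> may then
  replace \<open>z\<^sub>i\<close> (lemma \<open>compensation_exists\<close>).

  The supports of the \<open>z\<^sub>i\<close> reserve at most \<open>k L\<close> coordinates. For a set \<open>R\<close> of the other
  coordinates and fixed signs \<open>\<epsilon>\<^sub>j\<close>, let \<open>x\<^sub>R\<close> have the entries \<open>\<epsilon>\<^sub>j\<close> on \<open>R\<close> and \<open>0\<close> elsewhere; then
  \<open>x\<^sub>R - \<Sum>\<^sub>i c\<^sub>i(x\<^sub>R) z\<^sub>i\<close> lies in \<open>X\<close>. Two such points with different \<open>R\<close>, \<open>R'\<close> differ by at most
  \<open>1\<close> on the unreserved coordinates, with equality somewhere, and by \<open>\<bar>c\<^sub>i(x\<^sub>R) - c\<^sub>i(x\<^sub>R')\<bar>\<close> on the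
  support of \<open>z\<^sub>i\<close>. So any family of sets for which these last numbers are at most \<open>1\<close> yields a
  \<open>1\<close>-equilateral set (lemma \<open>card_le_equilateral_number\<close>). Such families are found as follows.

  \<^item> The bound \<open>2\<^sup>m / m\<^sup>k\<close> uses \<open>L = 1\<close>: on the subsets of \<open>m = n - k\<close> unreserved coordinates each \<open>c\<^sub>i\<close>
    takes values in an interval of length \<open>m\<close>. Cut each of these \<open>k\<close> intervals into \<open>m\<close> unit
    intervals; some cell receives at least \<open>2\<^sup>m / m\<^sup>k\<close> subsets.

  \<^item> The bound with subsets of \<open>n - k l\<close> coordinates uses \<open>L = l\<close>: for \<open>card R \<le> l\<close> all \<open>c\<^sub>i(x\<^sub>R)\<close> lie in \<open>[-1, 1]\<close>, so it suffices that
    their signs agree. The \<open>\<epsilon>\<^sub>j\<close> can be chosen to make one of the \<open>c\<^sub>i\<close> nonnegative for all \<open>R\<close>;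
    the other \<open>k - 1\<close> signs cost the factor \<open>2\<^sup>k\<^sup>-\<^sup>1\<close>, and the empty set fits every sign pattern.

  \<^item> The bound with subsets of \<open>n - 2 k l\<close> coordinates uses \<open>L = 2 l\<close>: for \<open>card R, card R' \<le> l\<close> the difference \<open>x\<^sub>R - x\<^sub>R'\<close> is itself a
    sign vector, so every pair is admissible.
\<close>

section \<open>Extremal systems of sign vectors\<close>

definition sign_vectors :: "nat \<Rightarrow> (real ^ 'n) set" where
  "sign_vectors L = {x. (\<forall>j. x $ j \<in> {-1, 0, 1}) \<and> card {j. x $ j \<noteq> 0} \<le> L}"

lemma finite_sign_vectors: "finite (sign_vectors L :: (real ^ 'n) set)"
proof (rule finite_subset)
  show "sign_vectors L \<subseteq> (vec_lambda ` (UNIV \<rightarrow>\<^sub>E {-1, 0, 1}) :: (real ^ 'n) set)"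
  proof
    fix x :: "real ^ 'n" assume "x \<in> sign_vectors L"
    then have "vec_nth x \<in> UNIV \<rightarrow>\<^sub>E {-1, 0, 1}"
      by (simp add: sign_vectors_def PiE_UNIV_domain)
    then show "x \<in> vec_lambda ` (UNIV \<rightarrow>\<^sub>E {-1, 0, 1})"
      by (intro image_eqI[of _ _ "vec_nth x"]) (simp_all add: vec_nth_inverse)
  qed
  show "finite (vec_lambda ` (UNIV \<rightarrow>\<^sub>E {-1, 0, 1}) :: (real ^ 'n) set)"
    by (intro finite_imageI finite_PiE) auto
qed

lemma axis_in_sign_vectors:
  assumes "1 \<le> L"
  shows "axis j 1 \<in> sign_vectors L"
proof -
  have "{i. axis j (1::real) $ i \<noteq> 0} = {j}"
    by (auto simp: axis_def)
  then show ?thesis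
    using assms by (auto simp: sign_vectors_def axis_def)
qed

definition sgn_indicator :: "('n \<Rightarrow> real) \<Rightarrow> 'n set \<Rightarrow> real ^ 'n" where
  "sgn_indicator \<epsilon> R = (\<chi> j. if j \<in> R then \<epsilon> j else 0)"

lemma sgn_indicator_sign_vector:
  assumes "\<And>j. \<bar>\<epsilon> j\<bar> = 1" "card R \<le> l"
  shows "sgn_indicator \<epsilon> R \<in> sign_vectors l"
proof -
  have "\<epsilon> j \<noteq> 0" "\<epsilon> j = -1 \<or> \<epsilon> j = 1" for j
    using assms(1)[of j] by auto
  then show ?thesis
    using assms(2) by (auto simp: sgn_indicator_def sign_vectors_def)
qed

text \<open>
  The conclusion of the extremal argument. The set \<open>I\<close> indexes the vectors \<open>z\<^sub>i\<close>; it is a subset of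
  the index type of the coordinates so that the \<open>z\<^sub>i\<close> and a basis of \<open>X\<close> can be the columns of
  one square matrix; \<open>c x\<close> stands for the coordinate vector of \<open>x\<close> in that basis.
\<close>

locale compensation =
  fixes X :: "(real ^ 'n) set" and L :: nat and I :: "'n set"
    and z :: "'n \<Rightarrow> real ^ 'n" and c :: "real ^ 'n \<Rightarrow> real ^ 'n"
  assumes linear_c: "linear c"
    and z_sign: "i \<in> I \<Longrightarrow> z i \<in> sign_vectors L"
    and z_disjoint: "i \<in> I \<Longrightarrow> j \<in> I \<Longrightarrow> i \<noteq> j \<Longrightarrow> z i $ t = 0 \<or> z j $ t = 0"
    and residual: "x - (\<Sum>i\<in>I. c x $ i *\<^sub>R z i) \<in> X"
    and c_bound: "i \<in> I \<Longrightarrow> x \<in> sign_vectors L \<Longrightarrow>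
      (\<And>j t. j \<in> I \<Longrightarrow> x $ t = 0 \<or> z j $ t = 0) \<Longrightarrow> \<bar>c x $ i\<bar> \<le> 1"

text \<open>
  Extending a basis of \<open>X\<close> by unit vectors shows that the determinant to be maximized is nonzero
  for at least one admissible system.
\<close>

lemma subspace_frame:
  fixes X :: "(real ^ 'n) set"
  assumes "subspace X"
  obtains I :: "'n set" and h :: "'n \<Rightarrow> real ^ 'n" where
    "card I + dim X = CARD('n)" "inj h" "span (range h) = UNIV"
    "\<And>i. i \<in> I \<Longrightarrow> h i \<in> range (\<lambda>j. axis j 1)" "\<And>i. i \<notin> I \<Longrightarrow> h i \<in> X"
proof -
  obtain B where B: "B \<subseteq> X" "independent B" "X \<subseteq> span B" "card B = dim X"
    using basis_exists by blast
  obtain B' where B': "B \<subseteq> B'" "B' \<subseteq> B \<union> Basis" "independent B'" "B \<union> Basis \<subseteq> span B'"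
    using maximal_independent_subset_extend[of B "B \<union> Basis"] B(2) by blast
  have span: "span B' = UNIV"
    using B'(4) span_minimal[of Basis "span B'"] by auto
  then have cB': "card B' = CARD('n)"
    using dim_eq_card[of B' UNIV] B'(3) by simp
  have fin: "finite B'"
    using B'(3) by (rule independent_imp_finite)
  obtain h :: "'n \<Rightarrow> real ^ 'n" where h: "bij_betw h UNIV B'"
    using finite_same_card_bij[of "UNIV :: 'n set" B'] fin cB' by auto
  define I where "I = {i. h i \<notin> B}"
  have "h ` (- I) = B"
    using h B'(1) by (auto simp: I_def bij_betw_def)
  then have "card (- I) = card B"
    using h by (metis bij_betw_def card_image inj_on_subset subset_UNIV)
  then have "card I + dim X = CARD('n)"
    using B(4) card_Un_disjoint[of I "- I"] by (simp add: Compl_partition)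
  moreover have "h i \<in> range (\<lambda>j. axis j 1)" if "i \<in> I" for i
  proof -
    have "h i \<in> B'" using h by (auto simp: bij_betw_def)
    then have "h i \<in> Basis" using that B'(2) by (auto simp: I_def)
    then show ?thesis by (auto simp: Basis_vec_def)
  qed
  moreover have "h i \<in> X" if "i \<notin> I" for i
    using that B(1) by (auto simp: I_def)
  ultimately show thesis
    using that[of I h] h span by (simp add: bij_betw_def)
qed

text \<open>
  The exchange argument: \<open>c\<close> expresses a vector in the basis formed by the system \<open>z\<close> of
  largest determinant and a basis of \<open>X\<close>. By Cramer's rule \<open>c x $ i\<close> is the factor by which the
  determinant changes when \<open>x\<close> replaces \<open>z i\<close>, which maximality bounds by \<open>1\<close>.
\<close>

lemma compensation_exists:
  fixes X :: "(real ^ 'n) set"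
  assumes X: "subspace X" and L: "1 \<le> L"
  obtains I z c where "card I + dim X = CARD('n)" "compensation X L I z c"
proof -
  obtain I :: "'n set" and h where I: "card I + dim X = CARD('n)"
    and h: "inj h" "span (range h) = UNIV"
      "\<And>i. i \<in> I \<Longrightarrow> h i \<in> range (\<lambda>j. axis j 1)" "\<And>i. i \<notin> I \<Longrightarrow> h i \<in> X"
    using subspace_frame[OF X] by blast
  define D :: "('n \<Rightarrow> real ^ 'n) \<Rightarrow> real ^ 'n ^ 'n" where "D z = (\<chi> r s. z s $ r)" for z
  \<comment> \<open>Off \<open>I\<close> the columns are the fixed basis of \<open>X\<close>; this also makes \<open>C\<close> finite.\<close>
  define C where "C = {z. (\<forall>i\<in>I. z i \<in> sign_vectors L) \<and> (\<forall>i. i \<notin> I \<longrightarrow> z i = h i)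
    \<and> (\<forall>i\<in>I. \<forall>j\<in>I. i \<noteq> j \<longrightarrow> (\<forall>t. z i $ t = 0 \<or> z j $ t = 0))}"
  have "C \<subseteq> (\<Pi>\<^sub>E i\<in>UNIV. insert (h i) (sign_vectors L))"
    by (auto simp: C_def PiE_UNIV_domain)
  moreover have "finite (\<Pi>\<^sub>E i\<in>UNIV. insert (h i) (sign_vectors L))"
    by (intro finite_PiE finite.insertI finite_sign_vectors) auto
  ultimately have finC: "finite C"
    by (rule finite_subset)
  have hC: "h \<in> C"
  proof -
    have "h i \<in> sign_vectors L" if "i \<in> I" for i
      using h(3)[OF that] axis_in_sign_vectors[OF L] by auto
    moreover have "h i $ t = 0 \<or> h j $ t = 0" if ij: "i \<in> I" "j \<in> I" "i \<noteq> j" for i j t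
    proof -
      obtain a b where ab: "h i = axis a 1" "h j = axis b 1"
        using h(3)[OF ij(1)] h(3)[OF ij(2)] by auto
      then have "a \<noteq> b" using h(1) ij(3) by (metis injD)
      then show ?thesis unfolding ab by (auto simp: axis_def)
    qed
    ultimately show ?thesis by (simp add: C_def)
  qed
  have "columns (D h) = range h"
    by (auto simp: columns_def column_def D_def vec_nth_inverse)
  then have "det (D h) \<noteq> 0"
    using h(2) matrix_right_invertible_span_columns[of "D h"] invertible_right_inverse[of "D h"]
    by (simp add: invertible_det_nz span_vec_eq)
  moreover obtain z where z: "z \<in> C" and zmax: "\<And>y. y \<in> C \<Longrightarrow> \<bar>det (D y)\<bar> \<le> \<bar>det (D z)\<bar>"
  proof -
    let ?V = "(\<lambda>y. \<bar>det (D y)\<bar>) ` C"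
    have "Max ?V \<in> ?V" using finC hC by (intro Max_in) auto
    then obtain z where "z \<in> C" "Max ?V = \<bar>det (D z)\<bar>" by auto
    then show thesis using that[of z] finC by (metis Max_ge finite_imageI imageI)
  qed
  ultimately have nz: "det (D z) \<noteq> 0"
    using hC by fastforce
  then obtain E where "D z ** E = mat 1"
    using invertible_right_inverse[of "D z"] by (auto simp: invertible_det_nz)
  define c where "c x = E *v x" for x
  have Dc: "D z *v c x = x" for x
    by (simp add: c_def matrix_vector_mul_assoc \<open>D z ** E = mat 1\<close>)
  have "compensation X L I z c"
  proof (rule compensation.intro)
    show "linear c"
      unfolding c_def by (rule matrix_vector_mul_linear)
    show "z i \<in> sign_vectors L" if "i \<in> I" for i
      using z that by (simp add: C_def)
    show "z i $ t = 0 \<or> z j $ t = 0" if "i \<in> I" "j \<in> I" "i \<noteq> j" for i j t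
      using z that by (simp add: C_def)
    show "x - (\<Sum>i\<in>I. c x $ i *\<^sub>R z i) \<in> X" for x
    proof -
      have "x = (\<Sum>i\<in>UNIV. c x $ i *\<^sub>R z i)"
        using Dc[of x] by (simp add: matrix_mult_sum column_def D_def scalar_mult_eq_scaleR vec_nth_inverse)
      also have "\<dots> = (\<Sum>i\<in>I. c x $ i *\<^sub>R z i) + (\<Sum>i\<in>-I. c x $ i *\<^sub>R z i)"
        by (subst sum.union_disjoint[symmetric]) (auto simp: Compl_partition)
      finally have "x - (\<Sum>i\<in>I. c x $ i *\<^sub>R z i) = (\<Sum>i\<in>-I. c x $ i *\<^sub>R z i)"
        by (metis add_diff_cancel_left')
      also have "\<dots> \<in> X"
        using z h(4) X by (intro subspace_sum subspace_scale) (auto simp: C_def)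
      finally show ?thesis .
    qed
    fix i x assume x: "i \<in> I" "x \<in> sign_vectors L"
      and dj: "\<And>j t. j \<in> I \<Longrightarrow> x $ t = 0 \<or> z j $ t = 0"
    show "\<bar>c x $ i\<bar> \<le> 1"
    proof -
      have "z(i := x) \<in> C"
        using z x dj by (auto simp: C_def)
      then have le: "\<bar>det (D (z(i := x)))\<bar> \<le> \<bar>det (D z)\<bar>"
        by (rule zmax)
      have "c x = (\<chi> s. det (\<chi> r t. if t = s then x $ r else D z $ r $ t) / det (D z))"
        using Dc[of x] cramer[OF nz] by blast
      moreover have "(\<chi> r t. if t = i then x $ r else D z $ r $ t) = D (z(i := x))"
        by (simp add: D_def vec_eq_iff)
      ultimately have "c x $ i = det (D (z(i := x))) / det (D z)"
        by simp
      then show ?thesis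
        using le nz by (simp add: abs_divide)
    qed
  qed
  with I show thesis by (rule that)
qed

section \<open>Two counting facts\<close>

lemma card_nonempty_small_subsets:
  fixes S :: "'a set"
  assumes "finite S"
  shows "card {R. R \<subseteq> S \<and> R \<noteq> {} \<and> card R \<le> l} = (\<Sum>r=1..l. card S choose r)"
proof -
  have fin: "finite R" if "R \<subseteq> S" for R
    using assms that by (rule rev_finite_subset)
  have "{R. R \<subseteq> S \<and> R \<noteq> {} \<and> card R \<le> l} = (\<Union>r\<in>{1..l}. {R. R \<subseteq> S \<and> card R = r})"
    using fin by (auto simp: Suc_le_eq card_gt_0_iff)
  also have "card \<dots> = (\<Sum>r=1..l. card {R. R \<subseteq> S \<and> card R = r})"
    using assms by (intro card_UN_disjoint) auto
  also have "\<dots> = (\<Sum>r=1..l. card S choose r)"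
    using assms by (simp add: n_subsets)
  finally show ?thesis .
qed

text \<open>
  The cells are closed, which is what lets \<open>m\<close> of them, rather than \<open>m + 1\<close>, cover \<open>[0, m]\<close>.
\<close>

lemma unit_cell_exists:
  fixes x :: real
  assumes "0 \<le> x" "x \<le> real m" "0 < m"
  shows "\<exists>q<m. real q \<le> x \<and> x \<le> real q + 1"
proof (cases "x = real m")
  case True
  then show ?thesis using assms(3) by (intro exI[of _ "m - 1"]) (auto simp: of_nat_diff)
next
  case False
  then have "x < real m" using assms(2) by simp
  then show ?thesis
    using assms(1) by (intro exI[of _ "nat \<lfloor>x\<rfloor>"]) linarith
qed

section \<open>Equilateral sets from compensated sign vectors\<close>

context compensation
begin

definition reserved :: "'n set" where
  "reserved = {t. \<exists>i\<in>I. z i $ t \<noteq> 0}"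

definition lift :: "real ^ 'n \<Rightarrow> real ^ 'n" where
  "lift x = x - (\<Sum>i\<in>I. c x $ i *\<^sub>R z i)"

lemma card_reserved: "card reserved \<le> card I * L"
proof -
  have "reserved = (\<Union>i\<in>I. {t. z i $ t \<noteq> 0})"
    by (auto simp: reserved_def)
  then have "card reserved \<le> (\<Sum>i\<in>I. card {t. z i $ t \<noteq> 0})"
    by (simp add: card_UN_le)
  also have "\<dots> \<le> (\<Sum>i\<in>I. L)"
    using z_sign by (intro sum_mono) (simp add: sign_vectors_def)
  finally show ?thesis by simp
qed

lemma c_bound_off_reserved:
  assumes "i \<in> I" "x \<in> sign_vectors L" "\<And>t. t \<in> reserved \<Longrightarrow> x $ t = 0"
  shows "\<bar>c x $ i\<bar> \<le> 1"
  using assms by (intro c_bound) (auto simp: reserved_def)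

lemma lift_diff: "lift (x - y) = lift x - lift y"
  by (simp add: lift_def linear_diff[OF linear_c] scaleR_left_diff_distrib sum_subtractf)

lemma lift_off_reserved: "t \<notin> reserved \<Longrightarrow> lift x $ t = x $ t"
  by (simp add: lift_def reserved_def)

text \<open>
  Disjointness of the supports makes a reserved coordinate feel exactly one \<open>z\<^sub>i\<close>, whose entry there
  is \<open>1\<close> or \<open>-1\<close>.
\<close>

lemma lift_on_reserved:
  assumes "t \<in> reserved" "x $ t = 0"
  shows "\<exists>i\<in>I. \<bar>lift x $ t\<bar> = \<bar>c x $ i\<bar>"
proof -
  obtain i where i: "i \<in> I" "z i $ t \<noteq> 0"
    using assms(1) by (auto simp: reserved_def)
  have "(\<Sum>j\<in>I. c x $ j * z j $ t) = (\<Sum>j\<in>I. if j = i then c x $ i * z i $ t else 0)"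
    using z_disjoint[OF _ i(1)] i(2) by (intro sum.cong) auto
  then have "lift x $ t = - (c x $ i * z i $ t)"
    using assms(2) i(1) by (simp add: lift_def sum.delta)
  moreover have "\<bar>z i $ t\<bar> = 1"
    using z_sign[OF i(1)] i(2) by (force simp: sign_vectors_def)
  ultimately show ?thesis
    using i(1) by (auto simp: abs_mult)
qed

lemma c_sgn_indicator: "c (sgn_indicator \<epsilon> R) $ i = (\<Sum>j\<in>R. \<epsilon> j * c (axis j 1) $ i)"
proof -
  have "sgn_indicator \<epsilon> R = (\<Sum>j\<in>R. \<epsilon> j *\<^sub>R axis j 1)"
    by (auto simp: sgn_indicator_def vec_eq_iff axis_def if_distrib sum.If_cases)
  then show ?thesis
    by (simp add: linear_sum[OF linear_c] linear_scale[OF linear_c])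
qed

text \<open>
  The lifts of the vectors \<open>x\<^sub>R\<close> are pairwise at distance \<open>1\<close>: a coordinate in the symmetric
  difference of \<open>R\<close> and \<open>R'\<close> contributes exactly \<open>1\<close>, the other unreserved ones \<open>0\<close>, and
  the reserved ones are controlled by the hypothesis on \<open>c\<close>.
\<close>

lemma card_le_equilateral_number:
  assumes \<epsilon>: "\<And>j. \<bar>\<epsilon> j\<bar> = 1" and off: "\<And>R. R \<in> \<R> \<Longrightarrow> R \<inter> reserved = {}"
    and close: "\<And>R R' i. R \<in> \<R> \<Longrightarrow> R' \<in> \<R> \<Longrightarrow> i \<in> I \<Longrightarrow>
      \<bar>c (sgn_indicator \<epsilon> R) $ i - c (sgn_indicator \<epsilon> R') $ i\<bar> \<le> 1"
  shows "card \<R> \<le> equilateral_number infnorm X"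
proof -
  let ?p = "\<lambda>R. lift (sgn_indicator \<epsilon> R)"
  have dist: "infnorm (?p R - ?p R') = 1" if R: "R \<in> \<R>" "R' \<in> \<R>" "R \<noteq> R'" for R R'
  proof -
    let ?x = "sgn_indicator \<epsilon> R - sgn_indicator \<epsilon> R'"
    have "\<bar>lift ?x $ t\<bar> \<le> 1" for t
    proof (cases "t \<in> reserved")
      case True
      then have "?x $ t = 0"
        using off R by (auto simp: sgn_indicator_def)
      with lift_on_reserved[OF True] obtain i where "i \<in> I" "\<bar>lift ?x $ t\<bar> = \<bar>c ?x $ i\<bar>"
        by blast
      then show ?thesis
        using close R by (simp add: linear_diff[OF linear_c])
    next
      case False
      then show ?thesis
        using \<epsilon>[of t] by (auto simp: lift_off_reserved sgn_indicator_def)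
    qed
    moreover have "\<exists>t. \<bar>lift ?x $ t\<bar> = 1"
    proof -
      obtain t where t: "t \<in> R \<longleftrightarrow> t \<notin> R'"
        using R(3) by blast
      then have "t \<notin> reserved" using off R by auto
      then have "\<bar>lift ?x $ t\<bar> = 1"
        using t \<epsilon>[of t] by (auto simp: lift_off_reserved sgn_indicator_def)
      then show ?thesis ..
    qed
    ultimately have "infnorm (lift ?x) = 1"
      unfolding infnorm_eq_Max_cart by (intro Max_eqI) (auto simp: image_iff eq_commute[of 1])
    then show ?thesis by (simp add: lift_diff)
  qed
  then have "inj_on ?p \<R>"
    by (intro inj_onI) (metis diff_self infnorm_0 zero_neq_one)
  moreover have "equilateral infnorm (?p ` \<R>)"
    unfolding equilateral_def c_equilateral_def using dist by (intro exI[of _ 1]) fastforce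
  moreover have "?p ` \<R> \<subseteq> X"
    using residual by (auto simp: lift_def)
  ultimately show ?thesis
    using equilateral_number_infnorm(2)[of "?p ` \<R>" X] by (simp add: card_image)
qed

lemma card_small_sets_off_reserved:
  "(\<Sum>r=1..l. (CARD('n) - card I * L) choose r)
    \<le> card {R. R \<subseteq> - reserved \<and> R \<noteq> {} \<and> card R \<le> l}"
proof -
  have "CARD('n) - card I * L \<le> card (- reserved)"
    using card_reserved by (simp add: Compl_eq_Diff_UNIV card_Diff_subset)
  then show ?thesis
    by (simp add: card_nonempty_small_subsets sum_mono binomial_right_mono)
qed

text \<open>
  The difference of two indicators with at most \<open>l\<close> nonzero entries each is a sign vector with at most
  \<open>L\<close> nonzero entries, so the extremal bound applies to the difference itself.
\<close>

lemma equilateral_number_ge_half: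
  assumes "2 * l \<le> L"
  shows "1 + (\<Sum>r=1..l. (CARD('n) - card I * L) choose r) \<le> equilateral_number infnorm X"
proof -
  let ?\<epsilon> = "\<lambda>_ :: 'n. 1 :: real"
  let ?\<G> = "{R. R \<subseteq> - reserved \<and> R \<noteq> {} \<and> card R \<le> l}"
  have "card (insert {} ?\<G>) \<le> equilateral_number infnorm X"
  proof (rule card_le_equilateral_number)
    fix R R' i assume R: "R \<in> insert {} ?\<G>" "R' \<in> insert {} ?\<G>" and i: "i \<in> I"
    let ?x = "sgn_indicator ?\<epsilon> R - sgn_indicator ?\<epsilon> R'"
    have "{j. ?x $ j \<noteq> 0} \<subseteq> R \<union> R'"
      by (auto simp: sgn_indicator_def split: if_splits)
    then have "card {j. ?x $ j \<noteq> 0} \<le> card R + card R'"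
      by (metis card_Un_le card_mono finite le_trans)
    also have "\<dots> \<le> L"
      using R assms by auto
    finally have "?x \<in> sign_vectors L"
      by (auto simp: sign_vectors_def sgn_indicator_def)
    moreover have "?x $ t = 0" if "t \<in> reserved" for t
      using R that by (auto simp: sgn_indicator_def)
    ultimately have "\<bar>c ?x $ i\<bar> \<le> 1"
      by (intro c_bound_off_reserved i)
    then show "\<bar>c (sgn_indicator ?\<epsilon> R) $ i - c (sgn_indicator ?\<epsilon> R') $ i\<bar> \<le> 1"
      by (simp add: linear_diff[OF linear_c])
  qed auto
  moreover have "card (insert {} ?\<G>) = 1 + card ?\<G>"
    by (subst card_insert_disjoint) auto
  ultimately show ?thesis
    using card_small_sets_off_reserved[of l] by linarith
qed

text \<open>
  Two vectors of \<open>[-1, 1]\<^sup>k\<close> in the same closed orthant differ by at most \<open>1\<close> in each component.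
  The signs \<open>\<epsilon>\<close> put all points on one side in direction \<open>i0\<close>, which halves the number of orthants.
\<close>

lemma equilateral_number_ge_orthant:
  assumes I: "i0 \<in> I"
  shows "1 + 1 / 2 ^ (card I - 1) * (\<Sum>r=1..L. real ((CARD('n) - card I * L) choose r))
    \<le> real (equilateral_number infnorm X)"
proof -
  \<comment> \<open>As \<open>c\<close> is odd, each unit vector or its negative has nonnegative component \<open>i0\<close> under \<open>c\<close>.\<close>
  define \<epsilon> :: "'n \<Rightarrow> real" where "\<epsilon> j = (if c (axis j 1) $ i0 \<ge> 0 then 1 else -1)" for j
  have \<epsilon>: "\<bar>\<epsilon> j\<bar> = 1" for j
    by (simp add: \<epsilon>_def)
  let ?c = "\<lambda>R. c (sgn_indicator \<epsilon> R)"
  define \<G> where "\<G> = {R. R \<subseteq> - reserved \<and> R \<noteq> {} \<and> card R \<le> L}"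
  define p where "p R = {i \<in> I - {i0}. ?c R $ i \<ge> 0}" for R
  have "\<exists>P\<in>Pow (I - {i0}). card \<G> \<le> card (p -` {P} \<inter> \<G>) * card (Pow (I - {i0}))"
    by (rule pigeonhole_card) (auto simp: p_def)
  then obtain P where P: "card \<G> \<le> card (p -` {P} \<inter> \<G>) * 2 ^ (card I - 1)"
    using I by (auto simp: card_Pow)
  define \<R> where "\<R> = p -` {P} \<inter> \<G>"
  have pos: "?c R $ i0 \<ge> 0" for R
    unfolding c_sgn_indicator by (intro sum_nonneg) (simp add: \<epsilon>_def)
  have bound: "\<bar>?c R $ i\<bar> \<le> 1" if "R \<in> \<G>" "i \<in> I" for R i
    using that \<epsilon> by (intro c_bound_off_reserved sgn_indicator_sign_vector)
      (auto simp: \<G>_def sgn_indicator_def)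
  have zero: "?c {} $ i = 0" for i
    by (simp add: c_sgn_indicator)
  have "card (insert {} \<R>) \<le> equilateral_number infnorm X"
  proof (rule card_le_equilateral_number[OF \<epsilon>])
    show "R \<inter> reserved = {}" if "R \<in> insert {} \<R>" for R
      using that by (auto simp: \<R>_def \<G>_def)
    fix R R' i assume R: "R \<in> insert {} \<R>" "R' \<in> insert {} \<R>" and i: "i \<in> I"
    show "\<bar>?c R $ i - ?c R' $ i\<bar> \<le> 1"
    proof (cases "R = {} \<or> R' = {}")
      case True
      then show ?thesis
        using R i bound[of R i] bound[of R' i] by (auto simp: zero \<R>_def)
    next
      case False
      then have RR: "R \<in> \<G>" "R' \<in> \<G>" "p R = p R'"
        using R by (auto simp: \<R>_def)
      have "?c R $ i \<ge> 0 \<longleftrightarrow> ?c R' $ i \<ge> 0"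
      proof (cases "i = i0")
        case True
        then show ?thesis using pos by simp
      next
        case False
        then have "i \<in> p R \<longleftrightarrow> ?c R $ i \<ge> 0" "i \<in> p R' \<longleftrightarrow> ?c R' $ i \<ge> 0"
          using i by (auto simp: p_def)
        then show ?thesis using RR by simp
      qed
      then show ?thesis
        using bound[OF RR(1) i] bound[OF RR(2) i] by linarith
    qed
  qed
  moreover have "card (insert {} \<R>) = 1 + card \<R>"
    by (subst card_insert_disjoint) (auto simp: \<R>_def \<G>_def)
  moreover have "1 / 2 ^ (card I - 1) * (\<Sum>r=1..L. real ((CARD('n) - card I * L) choose r)) \<le> card \<R>"
  proof -
    have "(\<Sum>r=1..L. (CARD('n) - card I * L) choose r) \<le> card \<R> * 2 ^ (card I - 1)"
      using card_small_sets_off_reserved[of L] P unfolding \<G>_def \<R>_def by linarith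
    then have "real (\<Sum>r=1..L. (CARD('n) - card I * L) choose r) \<le> real (card \<R> * 2 ^ (card I - 1))"
      by (simp only: of_nat_le_iff)
    then show ?thesis
      by (simp add: field_simps)
  qed
  ultimately show ?thesis
    by (smt (verit) of_nat_1 of_nat_add of_nat_mono)
qed

text \<open>
  For \<open>L = 1\<close> the bound on \<open>c\<close> applies to single unit vectors. Over all subsets of \<open>m\<close> unreserved
  coordinates a component of \<open>c\<close> is a subset sum of \<open>m\<close> numbers in \<open>[-1, 1]\<close>, hence ranges over an
  interval of length at most \<open>m\<close>, and the pigeonhole principle applies to its unit cells.
\<close>

lemma equilateral_number_ge_cells:
  assumes L: "L = 1" and m: "0 < m" "card I + m = CARD('n)"
  shows "2 ^ m / real m ^ card I \<le> real (equilateral_number infnorm X)"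
proof -
  let ?\<epsilon> = "\<lambda>_ :: 'n. 1 :: real"
  let ?c = "\<lambda>R. c (sgn_indicator ?\<epsilon> R)"
  have "m \<le> card (- reserved)"
    using card_reserved L m(2) by (simp add: Compl_eq_Diff_UNIV card_Diff_subset)
  then obtain S where S: "S \<subseteq> - reserved" "card S = m"
    using obtain_subset_with_card_n by metis
  \<comment> \<open>\<open>N i\<close> is the least subset sum, the left end of the interval.\<close>
  define N where "N i = (\<Sum>j\<in>S. min 0 (c (axis j 1) $ i))" for i
  have abs_le: "\<bar>c (axis j 1) $ i\<bar> \<le> 1" if "j \<in> S" "i \<in> I" for i j
    using that S(1) L by (intro c_bound_off_reserved axis_in_sign_vectors) (auto simp: axis_def)
  have lo: "0 \<le> ?c R $ i - N i" and hi: "?c R $ i - N i \<le> m"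
    if "R \<subseteq> S" "i \<in> I" for R i
  proof -
    have eq: "?c R $ i - N i
        = (\<Sum>j\<in>S. (if j \<in> R then c (axis j 1) $ i else 0) - min 0 (c (axis j 1) $ i))"
      using that(1) by (simp add: c_sgn_indicator N_def sum_subtractf sum.If_cases Int_absorb1)
    show "0 \<le> ?c R $ i - N i"
      unfolding eq by (intro sum_nonneg) (auto simp: min_def)
    have "?c R $ i - N i \<le> (\<Sum>j\<in>S. 1)"
      unfolding eq using abs_le that(2) by (intro sum_mono) (force simp: min_def abs_le_iff)
    then show "?c R $ i - N i \<le> m"
      using S(2) by simp
  qed
  define q where "q R i = (SOME q. q < m \<and> real q \<le> ?c R $ i - N i \<and> ?c R $ i - N i \<le> real q + 1)"
    for R i
  have q: "q R i < m \<and> real (q R i) \<le> ?c R $ i - N i \<and> ?c R $ i - N i \<le> real (q R i) + 1"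
    if "R \<subseteq> S" "i \<in> I" for R i
    unfolding q_def by (rule someI_ex) (rule unit_cell_exists[OF lo[OF that] hi[OF that] m(1)])
  define p where "p R = restrict (q R) I" for R
  have "\<exists>P\<in>I \<rightarrow>\<^sub>E {..<m}. card (Pow S) \<le> card (p -` {P} \<inter> Pow S) * card (I \<rightarrow>\<^sub>E {..<m})"
    using q m(1) by (intro pigeonhole_card finite_PiE) (auto simp: p_def PiE_eq_empty_iff)
  then obtain P where P: "2 ^ m \<le> card (p -` {P} \<inter> Pow S) * m ^ card I"
    using S(2) by (auto simp: card_Pow card_PiE)
  define \<R> where "\<R> = p -` {P} \<inter> Pow S"
  have "card \<R> \<le> equilateral_number infnorm X"
  proof (rule card_le_equilateral_number[of ?\<epsilon>])
    fix R R' i assume R: "R \<in> \<R>" "R' \<in> \<R>" and i: "i \<in> I"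
    then have "p R i = p R' i" "R \<subseteq> S" "R' \<subseteq> S"
      by (auto simp: \<R>_def)
    then have "q R i = q R' i"
      using i by (simp add: p_def)
    then show "\<bar>?c R $ i - ?c R' $ i\<bar> \<le> 1"
      using q[OF \<open>R \<subseteq> S\<close> i] q[OF \<open>R' \<subseteq> S\<close> i] by (simp add: abs_le_iff)
  qed (use S in \<open>auto simp: \<R>_def\<close>)
  moreover have "real (2 ^ m) \<le> real (card \<R> * m ^ card I)"
    using P unfolding \<R>_def by (simp only: of_nat_le_iff)
  then have "2 ^ m / real m ^ card I \<le> card \<R>"
    using m(1) by (simp add: field_simps)
  ultimately show ?thesis
    by (meson of_nat_le_iff order_trans)
qed

end

section \<open>The three bounds\<close>

theorem theorem1:
  fixes X :: "(real ^ 'n) set" and k :: nat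
  assumes "1 \<le> k" and "k < CARD('n)"
    and "subspace X" and "dim X = CARD('n) - k"
  shows "real (equilateral_number infnorm X) \<ge> 2 ^ (CARD('n) - k) / real (CARD('n) - k) ^ k
    \<and> (\<forall>l::nat. 1 \<le> l \<and> real l \<le> real CARD('n) / real (k + 1) \<longrightarrow>
        real (equilateral_number infnorm X)
          \<ge> 1 + 1 / 2 ^ (k - 1) * (\<Sum>r=1..l. real ((CARD('n) - k * l) choose r)))
    \<and> (\<forall>l::nat. 1 \<le> l \<and> real l \<le> real CARD('n) / real (2 * k + 1) \<longrightarrow>
        real (equilateral_number infnorm X)
          \<ge> 1 + (\<Sum>r=1..l. real ((CARD('n) - 2 * k * l) choose r)))"
proof (intro conjI allI impI)
  have card_I: "card I = k" if "card I + dim X = CARD('n)" for I :: "'n set"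
    using that assms by simp
  show "2 ^ (CARD('n) - k) / real (CARD('n) - k) ^ k \<le> real (equilateral_number infnorm X)"
  proof -
    obtain I z c where I: "card I + dim X = CARD('n)" and "compensation X 1 I z c"
      using compensation_exists[OF assms(3), of 1] by auto
    then interpret compensation X 1 I z c by simp
    show ?thesis
      using equilateral_number_ge_cells[of "CARD('n) - k"] card_I[OF I] assms(2) by simp
  qed
  fix l :: nat
  show "1 + 1 / 2 ^ (k - 1) * (\<Sum>r=1..l. real ((CARD('n) - k * l) choose r))
      \<le> real (equilateral_number infnorm X)"
    if l: "1 \<le> l \<and> real l \<le> real CARD('n) / real (k + 1)"
  proof -
    obtain I z c where I: "card I + dim X = CARD('n)" and "compensation X l I z c"
      using compensation_exists[OF assms(3), of l] l by blast
    then interpret compensation X l I z c by simp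
    obtain i0 where "i0 \<in> I"
      using card_I[OF I] assms(1) by fastforce
    then show ?thesis
      using equilateral_number_ge_orthant card_I[OF I] by simp
  qed
  show "1 + (\<Sum>r=1..l. real ((CARD('n) - 2 * k * l) choose r)) \<le> real (equilateral_number infnorm X)"
    if l: "1 \<le> l \<and> real l \<le> real CARD('n) / real (2 * k + 1)"
  proof -
    obtain I z c where I: "card I + dim X = CARD('n)" and "compensation X (2 * l) I z c"
      using compensation_exists[OF assms(3), of "2 * l"] l by auto
    then interpret compensation X "2 * l" I z c by simp
    have "1 + (\<Sum>r=1..l. (CARD('n) - 2 * k * l) choose r) \<le> equilateral_number infnorm X"
      using equilateral_number_ge_half[of l] card_I[OF I] by (simp add: ac_simps)
    then have "real (1 + (\<Sum>r=1..l. (CARD('n) - 2 * k * l) choose r))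
        \<le> real (equilateral_number infnorm X)"
      by (simp only: of_nat_le_iff)
    then show ?thesis by simp
  qed
qed

end
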